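(* All one-dimensional Fisher metrics are Hessian metrics: if $\{p_\theta:\theta\in\Theta\}$ is a regular statistical model with $\Theta\subset\mathbb{R}$ an open interval and Fisher metric $[g_{11}(\theta)]$, then there exists a strictly convex smooth function $F:\Theta\to\mathbb{R}$ such that $g_{11}(\theta)=F''(\theta)$ for all $\theta\in\Theta$.
   Context: For a regular statistical model (densities $p_\theta$ with respect to a fixed positive measure), the Fisher metric is the Riemannian metric on the open parameter set $\Theta$ whose matrix is the Fisher information matrix $I(\theta)=E_{p_\theta}[\nabla_\theta\log p_\theta\,(\nabla_\theta\log p_\theta)^\top]$, assumed positive-definite and smooth in $\theta$. A Riemannian metric on $\Theta$ is Hessian if in some coordinate system $\theta$ its matrix is $\nabla^2F(\theta)$ for a strictly convex smooth potential function $F$. *)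

theory Defs
  imports "HOL-Probability.Probability"
begin

(* Only meant for open S: then f is C^k iff it is continuous (k = 0), or differentiable
   with all directional derivatives of class C^(k-1) (k > 0). *)
primrec Ck_on :: "nat \<Rightarrow> 'a::euclidean_space set \<Rightarrow> ('a \<Rightarrow> 'b::real_normed_vector) \<Rightarrow> bool" where
  "Ck_on 0 S f \<longleftrightarrow> continuous_on S f"
| "Ck_on (Suc k) S f \<longleftrightarrow>
     f differentiable_on S \<and> (\<forall>v. Ck_on k S (\<lambda>x. frechet_derivative f (at x) v))"

definition smooth_on :: "'a::euclidean_space set \<Rightarrow> ('a \<Rightarrow> 'b::real_normed_vector) \<Rightarrow> bool" where
  "smooth_on S f \<longleftrightarrow> (\<forall>k. Ck_on k S f)"

definition strictly_convex_on :: "'a::real_vector set \<Rightarrow> ('a \<Rightarrow> real) \<Rightarrow> bool" where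
  "strictly_convex_on S f \<longleftrightarrow> convex S \<and>
     (\<forall>x\<in>S. \<forall>y\<in>S. \<forall>u>0. \<forall>v>0. x \<noteq> y \<longrightarrow> u + v = 1 \<longrightarrow>
        f (u *\<^sub>R x + v *\<^sub>R y) < u * f x + v * f y)"

definition gradient :: "('a::euclidean_space \<Rightarrow> real) \<Rightarrow> 'a \<Rightarrow> 'a" where
  "gradient f x = (\<Sum>b\<in>Basis. frechet_derivative f (at x) b *\<^sub>R b)"

(* The bilinear form (u, v) \<mapsto> u\<^sup>T (\<nabla>\<^sup>2 f(x)) v. *)
definition hessian_form :: "('a::euclidean_space \<Rightarrow> real) \<Rightarrow> 'a \<Rightarrow> 'a \<Rightarrow> 'a \<Rightarrow> real" where
  "hessian_form f x u v = frechet_derivative (\<lambda>y. frechet_derivative f (at y) u) (at x) v"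

(* A metric is a family of bilinear forms; its matrix entries in the standard coordinates
   are the values on pairs of Basis vectors. *)
definition riemannian_metric_on ::
    "'a::euclidean_space set \<Rightarrow> ('a \<Rightarrow> 'a \<Rightarrow> 'a \<Rightarrow> real) \<Rightarrow> bool" where
  "riemannian_metric_on \<Theta> g \<longleftrightarrow>
     (\<forall>\<theta>\<in>\<Theta>. bilinear (g \<theta>) \<and> (\<forall>u v. g \<theta> u v = g \<theta> v u) \<and> (\<forall>v. v \<noteq> 0 \<longrightarrow> g \<theta> v v > 0)) \<and>
     (\<forall>u v. smooth_on \<Theta> (\<lambda>\<theta>. g \<theta> u v))"

(* A global coordinate system \<eta> on \<Theta> with coordinate range \<Omega> and inverse \<psi>. *)
definition coordinate_system ::
    "'a::euclidean_space set \<Rightarrow> 'a set \<Rightarrow> ('a \<Rightarrow> 'a) \<Rightarrow> ('a \<Rightarrow> 'a) \<Rightarrow> bool" where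
  "coordinate_system \<Theta> \<Omega> \<eta> \<psi> \<longleftrightarrow>
     open \<Omega> \<and> homeomorphism \<Theta> \<Omega> \<eta> \<psi> \<and> smooth_on \<Theta> \<eta> \<and> smooth_on \<Omega> \<psi>"

(* The metric g in the coordinates y = \<eta>(\<theta>), that is, its pullback along \<psi>. *)
definition metric_in_coordinates ::
    "('a::euclidean_space \<Rightarrow> 'a) \<Rightarrow> ('a \<Rightarrow> 'a \<Rightarrow> 'a \<Rightarrow> real) \<Rightarrow> 'a \<Rightarrow> 'a \<Rightarrow> 'a \<Rightarrow> real" where
  "metric_in_coordinates \<psi> g y u v =
     g (\<psi> y) (frechet_derivative \<psi> (at y) u) (frechet_derivative \<psi> (at y) v)"

definition hessian_metric_on ::
    "'a::euclidean_space set \<Rightarrow> ('a \<Rightarrow> 'a \<Rightarrow> 'a \<Rightarrow> real) \<Rightarrow> bool" where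
  "hessian_metric_on \<Theta> g \<longleftrightarrow> riemannian_metric_on \<Theta> g \<and>
     (\<exists>\<Omega> \<eta> \<psi> F. coordinate_system \<Theta> \<Omega> \<eta> \<psi> \<and> strictly_convex_on \<Omega> F \<and> smooth_on \<Omega> F \<and>
        (\<forall>y\<in>\<Omega>. \<forall>u v. metric_in_coordinates \<psi> g y u v = hessian_form F y u v))"

definition model_distr :: "'x measure \<Rightarrow> ('a \<Rightarrow> 'x \<Rightarrow> real) \<Rightarrow> 'a \<Rightarrow> 'x measure" where
  "model_distr M p \<theta> = density M (\<lambda>x. ennreal (p \<theta> x))"

definition score :: "('a::euclidean_space \<Rightarrow> 'x \<Rightarrow> real) \<Rightarrow> 'a \<Rightarrow> 'x \<Rightarrow> 'a" where
  "score p \<theta> x = gradient (\<lambda>t. ln (p t x)) \<theta>"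

(* The bilinear form (u, v) \<mapsto> u\<^sup>T I(\<theta>) v of the Fisher information matrix I(\<theta>). *)
definition fisher_metric ::
    "'x measure \<Rightarrow> ('a::euclidean_space \<Rightarrow> 'x \<Rightarrow> real) \<Rightarrow> 'a \<Rightarrow> 'a \<Rightarrow> 'a \<Rightarrow> real" where
  "fisher_metric M p \<theta> u v =
     (\<integral>x. (score p \<theta> x \<bullet> u) * (score p \<theta> x \<bullet> v) \<partial>model_distr M p \<theta>)"

(* Differentiability of log p is asked for only almost surely under p_\<theta>, and is expressed through
   p: as p_\<theta>(x) > 0 almost surely, this is equivalent, and it avoids the convention ln 0 = 0. *)
definition regular_statistical_model ::
    "'x measure \<Rightarrow> 'a::euclidean_space set \<Rightarrow> ('a \<Rightarrow> 'x \<Rightarrow> real) \<Rightarrow> bool" where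
  "regular_statistical_model M \<Theta> p \<longleftrightarrow>
     open \<Theta> \<and>
     (\<forall>\<theta>\<in>\<Theta>.
        p \<theta> \<in> borel_measurable M \<and> (\<forall>x\<in>space M. 0 \<le> p \<theta> x) \<and>
        prob_space (model_distr M p \<theta>) \<and>
        (AE x in model_distr M p \<theta>. (\<lambda>t. p t x) differentiable (at \<theta>)) \<and>
        (\<forall>u v. integrable (model_distr M p \<theta>) (\<lambda>x. (score p \<theta> x \<bullet> u) * (score p \<theta> x \<bullet> v))) \<and>
        (\<forall>v. v \<noteq> 0 \<longrightarrow> fisher_metric M p \<theta> v v > 0)) \<and>
     (\<forall>u v. smooth_on \<Theta> (\<lambda>\<theta>. fisher_metric M p \<theta> u v))"

end

(* In dimension one the Fisher metric is u * v * g(\<theta>) for a smooth function g > 0. Integrating g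
   twice on the interval \<Theta> gives a smooth F with F'' = g > 0, hence strictly convex, and the
   identity serves as the coordinate system. *)
theory Submission
  imports Defs
begin

text \<open>Since \<open>S\<close> is open, agreement on \<open>S\<close> is agreement near each of
  its points, so the two functions have the same Frechet derivatives on \<open>S\<close>. The
  induction varies both functions because its hypothesis is applied to their directional
  derivatives.\<close>

lemma Ck_on_cong:
  assumes "open S" "\<And>x. x \<in> S \<Longrightarrow> f x = g x" "Ck_on k S f"
  shows "Ck_on k S g"
  using assms(2,3)
proof (induction k arbitrary: f g)
  case 0
  then show ?case by (simp cong: continuous_on_cong)
next
  case (Suc k)
  have deriv: "(g has_derivative frechet_derivative f (at x)) (at x)" if "x \<in> S" for x
  proof -
    have "(f has_derivative frechet_derivative f (at x)) (at x)"
      using Suc.prems(2) that \<open>open S\<close>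
      by (auto simp: differentiable_on_eq_differentiable_at frechet_derivative_works[symmetric])
    then show ?thesis
      by (rule has_derivative_transform_within_open[OF _ \<open>open S\<close> that]) (simp add: Suc.prems(1))
  qed
  have "g differentiable_on S"
    using deriv \<open>open S\<close> by (auto simp: differentiable_on_eq_differentiable_at differentiable_def)
  moreover have "Ck_on k S (\<lambda>x. frechet_derivative g (at x) v)" for v
  proof (rule Suc.IH)
    show "frechet_derivative f (at x) v = frechet_derivative g (at x) v" if "x \<in> S" for x
      using frechet_derivative_at[OF deriv[OF that]] by simp
    show "Ck_on k S (\<lambda>x. frechet_derivative f (at x) v)"
      using Suc.prems(2) by simp
  qed
  ultimately show ?case by simp
qed

text \<open>Replaces the chosen \<open>frechet_derivative\<close> in \<open>Ck_on\<close> by any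
  explicit formula \<open>D\<close> for the derivative on \<open>S\<close>; derivatives are unique,
  and \<open>Ck_on_cong\<close> transfers the class.\<close>

lemma Ck_on_SucI:
  assumes "open S" "\<And>x. x \<in> S \<Longrightarrow> (f has_derivative D x) (at x)" "\<And>v. Ck_on k S (\<lambda>x. D x v)"
  shows "Ck_on (Suc k) S f"
proof -
  have "f differentiable_on S"
    using assms(1,2) by (auto simp: differentiable_on_eq_differentiable_at differentiable_def)
  moreover have "Ck_on k S (\<lambda>x. frechet_derivative f (at x) v)" for v
  proof (rule Ck_on_cong[OF \<open>open S\<close> _ assms(3)])
    show "D x v = frechet_derivative f (at x) v" if "x \<in> S" for x
      using frechet_derivative_at[OF assms(2)[OF that]] by simp
  qed
  ultimately show ?thesis by simp
qed

lemma Ck_on_const: "Ck_on k S (\<lambda>x. c)"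
  by (induction k arbitrary: c) auto

lemma Ck_on_scaleR:
  assumes "open S" "Ck_on k S f"
  shows "Ck_on k S (\<lambda>x. c *\<^sub>R f x)"
  using assms(2)
proof (induction k arbitrary: f)
  case 0
  then show ?case by (auto intro: continuous_intros)
next
  case (Suc k)
  have "((\<lambda>x. c *\<^sub>R f x) has_derivative (\<lambda>v. c *\<^sub>R frechet_derivative f (at x) v)) (at x)"
    if "x \<in> S" for x
    using Suc.prems that \<open>open S\<close>
    by (intro has_derivative_scaleR_right)
      (auto simp: differentiable_on_eq_differentiable_at frechet_derivative_works[symmetric])
  moreover have "Ck_on k S (\<lambda>x. c *\<^sub>R frechet_derivative f (at x) v)" for v
    using Suc by simp
  ultimately show ?case by (rule Ck_on_SucI[OF \<open>open S\<close>])
qed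

lemma smooth_on_ident:
  assumes "open S"
  shows "smooth_on S (\<lambda>x. x)"
  unfolding smooth_on_def
proof
  show "Ck_on k S (\<lambda>x. x)" for k
  proof (cases k)
    case (Suc j)
    then show ?thesis
      \<comment> \<open>The derivative \<open>\<lambda>_ v. v\<close> does not depend on the base
        point, so each directional derivative is a constant function.\<close>
      using Ck_on_SucI[OF assms, of "\<lambda>x. x" "\<lambda>_ v. v" j]
      by (simp only: Ck_on_const has_derivative_ident simp_thms)
  qed simp
qed

text \<open>The directional derivative of \<open>f\<close> along \<open>v\<close> is
  \<open>v * g x\<close>, so class \<open>j\<close> of \<open>g\<close> gives class
  \<open>Suc j\<close> of \<open>f\<close>; a case distinction on the order suffices, as
  \<open>g\<close> has every class.\<close>

lemma smooth_on_antiderivative: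
  fixes f g :: "real \<Rightarrow> real"
  assumes "open S" "\<And>x. x \<in> S \<Longrightarrow> (f has_real_derivative g x) (at x)" "smooth_on S g"
  shows "smooth_on S f"
  unfolding smooth_on_def
proof
  show "Ck_on k S f" for k
  proof (cases k)
    case 0
    have "continuous_on S f"
      using assms(2) by (auto intro!: continuous_at_imp_continuous_on DERIV_isCont)
    then show ?thesis using 0 by simp
  next
    case (Suc j)
    have "Ck_on (Suc j) S f"
    proof (rule Ck_on_SucI[OF \<open>open S\<close>])
      show "(f has_derivative (\<lambda>v. v * g x)) (at x)" if "x \<in> S" for x
        using assms(2)[OF that] by (simp add: has_field_derivative_def mult_commute_abs)
      show "Ck_on j S (\<lambda>x. v * g x)" for v
        using Ck_on_scaleR[OF \<open>open S\<close>, of j g v] assms(3) by (simp add: smooth_on_def)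
    qed
    then show ?thesis using Suc by simp
  qed
qed

lemma open_interval_antiderivative_exists:
  fixes g :: "real \<Rightarrow> real"
  assumes "open S" "is_interval S" "continuous_on S g"
  obtains G where "\<And>x. x \<in> S \<Longrightarrow> (G has_real_derivative g x) (at x)"
proof (cases "S = {}")
  case False
  then obtain c where c: "c \<in> S" by blast
  \<comment> \<open>The base point \<open>c\<close> is the same for all \<open>x\<close>. The
    interval integral is oriented, so one formula serves on both sides of \<open>c\<close>.\<close>
  have "((\<lambda>u. LBINT y=c..u. g y) has_real_derivative g x) (at x)" if x: "x \<in> S" for x
  proof -
    obtain e where e: "e > 0" "cball x e \<subseteq> S"
      using \<open>open S\<close> x open_contains_cball by blast
    \<comment> \<open>The compact interval \<open>{a..b}\<close> stays in \<open>S\<close>, contains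
      \<open>c\<close> as the fundamental theorem requires, and has \<open>x\<close> in its
      interior, which turns the derivative within \<open>{a..b}\<close> into a two-sided
      one.\<close>
    define a b where "a = min c (x - e)" and "b = max c (x + e)"
    have "a \<in> S" "b \<in> S"
      using e c by (auto simp: a_def b_def min_def max_def subset_iff dist_real_def)
    then have sub: "{a..b} \<subseteq> S"
      using \<open>is_interval S\<close> by (meson atLeastAtMost_iff mem_is_interval_1_I subsetI)
    have ab: "a \<le> c" "c \<le> b" "a < x" "x < b"
      using e by (auto simp: a_def b_def)
    have "((\<lambda>u. LBINT y=c..u. g y) has_vector_derivative g x) (at x within {a..b})"
      using ab sub assms(3) by (intro interval_integral_FTC2) (auto intro: continuous_on_subset)
    then show ?thesis
      using ab by (simp add: has_real_derivative_iff_has_vector_derivative at_within_Icc_at)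
  qed
  then show ?thesis by (rule that)
qed (use that in auto)

text \<open>By the mean value theorem, the chord slopes of \<open>F\<close> to the left and to the
  right of the intermediate point are values of \<open>G\<close> at two increasing arguments, hence
  strictly increasing.\<close>

lemma strictly_convex_on_real:
  fixes F G :: "real \<Rightarrow> real"
  assumes "convex S"
    and F: "\<And>x. x \<in> S \<Longrightarrow> (F has_real_derivative G x) (at x)"
    and G: "strict_mono_on S G"
  shows "strictly_convex_on S F"
proof -
  have less: "F (u * x + v * y) < u * F x + v * F y"
    if "x \<in> S" "y \<in> S" "x < y" "u > 0" "v > 0" "u + v = 1" for x y u v
  proof -
    define z where "z = u * x + v * y"
    have u: "u = 1 - v" using that by simp
    have zx: "z - x = v * (y - x)" and yz: "y - z = u * (y - x)"
      by (simp_all add: z_def u algebra_simps)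
    have xz: "x < z" "z < y"
      using zx yz that by (metis diff_gt_0_iff_gt mult_pos_pos)+
    have sub: "t \<in> S" if "x \<le> t" "t \<le> y" for t
      using \<open>convex S\<close> \<open>x \<in> S\<close> \<open>y \<in> S\<close> that mem_is_interval_1_I is_interval_convex_1 by blast
    obtain r where r: "x < r" "r < z" "F z - F x = (z - x) * G r"
      using MVT2[OF xz(1), of F G] F sub xz by force
    obtain s where s: "z < s" "s < y" "F y - F z = (y - z) * G s"
      using MVT2[OF xz(2), of F G] F sub xz by force
    have "G r < G s"
      using G r s xz sub by (intro strict_mono_onD[OF G]) auto
    \<comment> \<open>The factor \<open>u * v * (y - x)\<close> is both \<open>u * (z - x)\<close>
      and \<open>v * (y - z)\<close>, so the two mean value equations turn the sides into increments
      of \<open>F\<close>.\<close>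
    then have "u * (v * (y - x)) * G r < u * (v * (y - x)) * G s"
      using that by (intro mult_strict_left_mono) auto
    then have "u * (F z - F x) < v * (F y - F z)"
      by (simp add: r s zx yz algebra_simps)
    then have "F z < u * F x + v * F y" by (simp add: u algebra_simps)
    then show ?thesis by (simp add: z_def)
  qed
  have "F (u * x + v * y) < u * F x + v * F y"
    if "x \<in> S" "y \<in> S" "x \<noteq> y" "u > 0" "v > 0" "u + v = 1" for x y u v
  proof (cases "x < y")
    case False
    \<comment> \<open>Here \<open>y < x\<close>: the points are exchanged together with their
      weights.\<close>
    then show ?thesis using less[of y x v u] that by (simp add: add.commute)
  qed (use less that in simp)
  then show ?thesis using \<open>convex S\<close> by (simp add: strictly_convex_on_def)
qed

text \<open>On the reals the inner product is multiplication, so both directions pull out of the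
  integral as constants.\<close>

lemma fisher_metric_real:
  fixes p :: "real \<Rightarrow> 'x \<Rightarrow> real"
  shows "fisher_metric M p \<theta> u v = u * v * fisher_metric M p \<theta> 1 1"
proof -
  have "fisher_metric M p \<theta> u v
      = (\<integral>x. (u * v) * (score p \<theta> x * score p \<theta> x) \<partial>model_distr M p \<theta>)"
    unfolding fisher_metric_def by (simp add: mult_ac)
  then show ?thesis by (simp add: fisher_metric_def)
qed

text \<open>Positivity and smoothness are part of regularity, and symmetry is commutativity under
  the integral; bilinearity comes from the product form in
  \<open>fisher_metric_real\<close>.\<close>

lemma riemannian_metric_on_fisher_metric_real:
  fixes p :: "real \<Rightarrow> 'x \<Rightarrow> real"
  assumes "regular_statistical_model M \<Theta> p"
  shows "riemannian_metric_on \<Theta> (fisher_metric M p)"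
proof -
  have "bilinear (fisher_metric M p \<theta>)" for \<theta>
  proof -
    have "fisher_metric M p \<theta> = (\<lambda>u v. u * v * fisher_metric M p \<theta> 1 1)"
      using fisher_metric_real by blast
    moreover have "bilinear (\<lambda>u v :: real. u * v * c)" for c :: real
      by (auto intro!: linearI simp: bilinear_def algebra_simps)
    ultimately show ?thesis by metis
  qed
  moreover have "fisher_metric M p \<theta> u v = fisher_metric M p \<theta> v u" for \<theta> u v
    by (simp add: fisher_metric_def mult.commute)
  ultimately show ?thesis
    using assms by (auto simp: riemannian_metric_on_def regular_statistical_model_def)
qed

text \<open>The inner derivative is \<open>u * G y\<close> only for \<open>y\<close> in
  \<open>S\<close>; openness of \<open>S\<close> makes this enough to differentiate once more at
  \<open>x\<close>.\<close>

lemma hessian_form_real: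
  fixes F G :: "real \<Rightarrow> real" and g :: real
  assumes "open S" "x \<in> S"
    and F: "\<And>y. y \<in> S \<Longrightarrow> (F has_real_derivative G y) (at y)"
    and G: "(G has_real_derivative g) (at x)"
  shows "hessian_form F x u v = u * v * g"
proof -
  have "frechet_derivative F (at y) u = u * G y" if "y \<in> S" for y
    using frechet_derivative_at[OF F[OF that, unfolded has_field_derivative_def], symmetric]
    by simp
  moreover have "((\<lambda>y. u * G y) has_derivative (\<lambda>v. u * v * g)) (at x)"
    using DERIV_cmult[OF G, of u] by (simp add: has_field_derivative_def mult_ac mult_commute_abs)
  ultimately have "((\<lambda>y. frechet_derivative F (at y) u) has_derivative (\<lambda>v. u * v * g)) (at x)"
    using assms(1,2) by (auto intro: has_derivative_transform_within_open)
  then show ?thesis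
    unfolding hessian_form_def using frechet_derivative_at by metis
qed

text \<open>Counterpart of \<open>hessian_form_real\<close> for the iterated \<open>deriv\<close>:
  \<open>deriv F\<close> agrees with \<open>G\<close> near \<open>x\<close>.\<close>

lemma deriv_deriv_real:
  fixes F G :: "real \<Rightarrow> real" and g :: real
  assumes "open S" "x \<in> S"
    and F: "\<And>y. y \<in> S \<Longrightarrow> (F has_real_derivative G y) (at y)"
    and G: "(G has_real_derivative g) (at x)"
  shows "(deriv ^^ 2) F x = g"
proof -
  have "(deriv F has_real_derivative g) (at x)"
    using has_field_derivative_transform_within_open[OF G assms(1,2)] F DERIV_imp_deriv by metis
  then show ?thesis by (simp add: numeral_2_eq_2 DERIV_imp_deriv)
qed

theorem mainTheorem12:
  fixes M :: "'x measure" and \<Theta> :: "real set" and p :: "real \<Rightarrow> 'x \<Rightarrow> real"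
  assumes "open \<Theta>" and "is_interval \<Theta>"
    and "regular_statistical_model M \<Theta> p"
  shows "hessian_metric_on \<Theta> (fisher_metric M p) \<and>
    (\<exists>F :: real \<Rightarrow> real. strictly_convex_on \<Theta> F \<and> smooth_on \<Theta> F \<and>
       (\<forall>\<theta>\<in>\<Theta>. fisher_metric M p \<theta> 1 1 = (deriv ^^ 2) F \<theta>))"
proof -
  define g where "g \<theta> = fisher_metric M p \<theta> 1 1" for \<theta>
  have g_smooth: "smooth_on \<Theta> g" and g_pos: "\<And>\<theta>. \<theta> \<in> \<Theta> \<Longrightarrow> g \<theta> > 0"
    using assms(3) by (simp_all add: regular_statistical_model_def g_def[abs_def])
  have "Ck_on 0 \<Theta> g"
    using g_smooth unfolding smooth_on_def by blast
  then have "continuous_on \<Theta> g" by simp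
  then obtain G where G: "\<And>x. x \<in> \<Theta> \<Longrightarrow> (G has_real_derivative g x) (at x)"
    using open_interval_antiderivative_exists assms(1,2) by blast
  then have "continuous_on \<Theta> G"
    by (auto intro!: continuous_at_imp_continuous_on DERIV_isCont)
  then obtain F where F: "\<And>x. x \<in> \<Theta> \<Longrightarrow> (F has_real_derivative G x) (at x)"
    using open_interval_antiderivative_exists assms(1,2) by blast
  \<comment> \<open>Smoothness climbs from \<open>g\<close> to \<open>G\<close> and then from
    \<open>G\<close> to \<open>F\<close>.\<close>
  have F_smooth: "smooth_on \<Theta> F"
    using smooth_on_antiderivative[OF assms(1)] F G g_smooth by metis
  have "strict_mono_on \<Theta> G"
  proof (rule strict_mono_onI)
    fix r s assume rs: "r \<in> \<Theta>" "s \<in> \<Theta>" "r < s"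
    have "t \<in> \<Theta>" if "r \<le> t" "t \<le> s" for t
      using rs that assms(2) mem_is_interval_1_I by blast
    then show "G r < G s"
      using DERIV_pos_imp_increasing[OF rs(3), of G] G g_pos by blast
  qed
  then have F_convex: "strictly_convex_on \<Theta> F"
    using strictly_convex_on_real F assms(2) is_interval_convex_1 by blast
  have "coordinate_system \<Theta> \<Theta> (\<lambda>x. x) (\<lambda>x. x)"
    using assms(1) by (simp add: coordinate_system_def smooth_on_ident homeomorphism_def)
  \<comment> \<open>The derivative of the identity fixes every direction, so the pullback is the
    Fisher metric itself, and both sides equal \<open>u * v * g y\<close>.\<close>
  moreover have "metric_in_coordinates (\<lambda>x. x) (fisher_metric M p) y u v = hessian_form F y u v"
    if "y \<in> \<Theta>" for y u v
    using hessian_form_real[OF assms(1) that F G[OF that]] fisher_metric_real[of M p y u v]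
    by (simp add: metric_in_coordinates_def g_def)
  ultimately have "hessian_metric_on \<Theta> (fisher_metric M p)"
    using riemannian_metric_on_fisher_metric_real[OF assms(3)] F_smooth F_convex
    unfolding hessian_metric_on_def by blast
  moreover have "fisher_metric M p \<theta> 1 1 = (deriv ^^ 2) F \<theta>" if "\<theta> \<in> \<Theta>" for \<theta>
    using deriv_deriv_real[OF assms(1) that F G[OF that]] by (simp add: g_def)
  ultimately show ?thesis using F_smooth F_convex by blast
qed

end
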